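(* (i) For any $n=0,1,2,\ldots$ $$\int_O t^{q^n}\,dt=-\frac{1}{[n+1]}.$$ (ii) For any $n=0,1,2,\ldots$ $$\int_O f_n(t)\,dt=\frac{(-1)^{n+1}}{L_{n+1}}.$$ (iii) If $z\in K$, $|z|<1$, then $$\int_O C_s(z)\,ds=\log_C(z)-z .$$
   Context: Let $\mathbf F_q$ be the finite field with $q=p^\gamma$ elements ($p$ prime, $\gamma\ge 1$), and let $K=\mathbf F_q((x))$ with absolute value $|z|=q^{-n}$ for $z=\sum_{i=n}^\infty\zeta_i x^i$, $\zeta_i\in\mathbf F_q$, $\zeta_n\neq 0$. Let $O=\{z\in K:|z|\le1\}$ and let $\overline{K}_c$ be the completion of an algebraic closure of $K$, with the extended absolute value. A function $u:O\to\overline{K}_c$ is $\mathbf F_q$-linear if it is additive and $u(\alpha t)=\alpha u(t)$ for all $\alpha\in\mathbf F_q$, $t\in O$. $C_0(O,\overline{K}_c)$ is the Banach space of continuous $\mathbf F_q$-linear functions $O\to\overline{K}_c$ with the supremum norm, and $C_0^1(O,\overline{K}_c)$ is the set of those $u\in C_0(O,\overline{K}_c)$ for which $t\mapsto t^{-1}u(t)$ extends continuously from $O\setminus\{0\}$ to $O$. Put $[i]=x^{q^i}-x$; $D_0=L_0=1$; $D_i=[i]\,[i-1]^q\cdots[1]^{q^{i-1}}$, $L_i=[i][i-1]\cdots[1]$ for $i\ge1$. The normalized Carlitz polynomials are $f_i(t)=D_i^{-1}e_i(t)$, $i\ge0$, where $e_0(t)=t$ and $e_i(t)=\prod_{m\in\mathbf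 F_q[x],\,\deg m<i}(t-m)$ for $i\ge1$ (including $m=0$). It is known that every $f\in C_0(O,\overline{K}_c)$ has a unique uniformly convergent expansion $f=\sum_{k\ge0}\varphi_kf_k$, $\varphi_k\in\overline{K}_c$, $\varphi_k\to0$. Indefinite sum: for $f\in C_0(O,\overline{K}_c)$, $Sf$ is the unique $u\in C_0(O,\overline{K}_c)$ satisfying $u(xt)-xu(t)=f(t)^q$ for all $t\in O$ and $u(1)=0$. (Explicitly, if $f=\sum_k\varphi_kf_k$ then $Sf=\sum_k\varphi_k^qf_{k+1}$.) Volkenborn-type integral: for $f\in C_0^1(O,\overline{K}_c)$, $$\int_Of(t)\,dt=\lim_{n\to\infty}\frac{(Sf)(x^n)}{x^n}=(Sf)'(0).$$ Carlitz module function: for $z\in K$, $|z|<1$ and $s\in O$, $C_s(z)=\sum_{i=0}^\infty f_i(s)z^{q^i}$; for fixed $z$ it is, as a function of $s$, an element of $C_0^1(O,\overline{K}_c)$, and $\int_OC_s(z)\,ds$ is its integral with respect to $s$. Carlitz logarithm: $\log_C(z)=\sum_{n=0}^\infty(-1)^n\frac{z^{q^n}}{L_n}$ for $|z|<1$. *)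

theory Defs
  imports
    "HOL-Analysis.Analysis"
    "HOL-Computational_Algebra.Computational_Algebra"
begin

text \<open>
  The finite field is a type \<open>'a :: {field, finite}\<close> with \<open>q = CARD('a)\<close>; every finite field has
  prime-power order, so all \<open>q = p ^ \<gamma>\<close> are covered.  The local field \<open>K\<close> is
  \<open>'a fls\<close>, and \<open>fls_X\<close> is \<open>x\<close>.
\<close>

definition fls_abs :: "'a::{field,finite} fls \<Rightarrow> real" where
  "fls_abs z = (if z = 0 then 0 else real CARD('a) powi (- fls_subdegree z))"

definition int_ring :: "'a::{field,finite} fls set" where
  "int_ring = {z. fls_abs z \<le> 1}"

text \<open>
  The library metric on \<open>'a fls\<close> uses the base \<open>2\<close> instead of \<open>q\<close>.  The
  two topologies agree, so \<^const>\<open>continuous_on\<close> has its intended meaning on subsets of \<open>K\<close>.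
\<close>

lemma fls_abs_less_iff:
  fixes z :: "'a::{field,finite} fls"
  shows "fls_abs z < real CARD('a) powi (- n) \<longleftrightarrow> z = 0 \<or> n < fls_subdegree z"
proof -
  have "card {0, 1 :: 'a} \<le> CARD('a)"
    by (rule card_mono) auto
  then have q: "real CARD('a) > 1"
    by simp
  show ?thesis
  proof (cases "z = 0")
    case True
    then show ?thesis using q by (simp add: fls_abs_def)
  next
    case False
    have "real CARD('a) powi a < real CARD('a) powi b \<longleftrightarrow> a < b" for a b
      using power_int_strict_increasing[OF _ q] power_int_increasing[of _ _ "real CARD('a)"] q
      by (metis less_eq_real_def not_less)
    then show ?thesis using False by (simp add: fls_abs_def)
  qed
qed

lemma dist_fls_less_iff:
  fixes a b :: "'a::{field,finite} fls"
  shows "dist a b < 2 powi (- n) \<longleftrightarrow> a = b \<or> n < fls_subdegree (a - b)"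
proof (cases "a = b")
  case False
  have "(2::real) powi k < 2 powi l \<longleftrightarrow> k < l" for k l
    using power_int_strict_increasing[of _ _ "2::real"] power_int_increasing[of _ _ "2::real"]
    by (metis less_eq_real_def not_less one_less_numeral_iff semiring_norm(76))
  moreover have "dist a b = 2 powi (- fls_subdegree (a - b))"
    using False by (auto simp: dist_fls_def power_int_def inverse_eq_divide power_one_over)
  ultimately show ?thesis using False by simp
qed simp

lemma open_fls_iff_fls_abs:
  fixes U :: "'a::{field,finite} fls set"
  shows "open U \<longleftrightarrow> (\<forall>a\<in>U. \<exists>e>0. \<forall>b. fls_abs (b - a) < e \<longrightarrow> b \<in> U)"
proof -
  have small: "\<exists>n. c powi (- n) < e" if ce: "c > 1" "e > 0" for c e :: real
  proof -
    obtain k where "inverse c ^ k < e"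
      using real_arch_pow_inv[OF ce(2), of "inverse c"] ce(1) by (auto simp: inverse_less_1_iff)
    then show ?thesis
      by (intro exI[of _ "int k"]) (simp add: power_int_minus power_inverse)
  qed
  have "card {0, 1 :: 'a} \<le> CARD('a)"
    by (rule card_mono) auto
  then have q: "real CARD('a) > 1"
    by simp
  have *: "dist b a < 2 powi (- n) \<longleftrightarrow> fls_abs (b - a) < real CARD('a) powi (- n)"
    for a b :: "'a fls" and n
    by (simp add: dist_fls_less_iff fls_abs_less_iff)
  show ?thesis
    unfolding open_dist
  proof (intro ball_cong refl iffI)
    fix a assume "\<exists>e>0. \<forall>y. dist y a < e \<longrightarrow> y \<in> U"
    then obtain e where e: "e > 0" "\<And>y. dist y a < e \<Longrightarrow> y \<in> U" by blast
    obtain n where "2 powi (- n) < e" using small[of 2 e] e by auto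
    with e * show "\<exists>e>0. \<forall>b. fls_abs (b - a) < e \<longrightarrow> b \<in> U"
      using q by (intro exI[of _ "real CARD('a) powi (- n)"]) (metis less_trans zero_less_one zero_less_power_int)
  next
    fix a assume "\<exists>e>0. \<forall>b. fls_abs (b - a) < e \<longrightarrow> b \<in> U"
    then obtain e where e: "e > 0" "\<And>y. fls_abs (y - a) < e \<Longrightarrow> y \<in> U" by blast
    obtain n where "real CARD('a) powi (- n) < e" using small[OF q e(1)] by auto
    with e * show "\<exists>e>0. \<forall>y. dist y a < e \<longrightarrow> y \<in> U"
      by (intro exI[of _ "2 powi (- n)"]) (metis less_trans zero_less_numeral zero_less_power_int)
  qed
qed

text \<open>
  \<open>A\<close> is an algebraic closure of the image of \<open>K\<close> under \<open>emb\<close>, realised as a subfield of the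
  ambient field \<open>'c\<close>.
\<close>

definition algebraic_closure_in ::
    "('a::{field,finite} fls \<Rightarrow> 'c::field) \<Rightarrow> 'c set \<Rightarrow> bool" where
  "algebraic_closure_in emb A \<longleftrightarrow>
     range emb \<subseteq> A \<and>
     (\<forall>a\<in>A. \<forall>b\<in>A. a - b \<in> A \<and> a * b \<in> A \<and> inverse a \<in> A) \<and>
     (\<forall>a\<in>A. \<exists>p. p \<noteq> 0 \<and> poly (map_poly emb p) a = 0) \<and>
     (\<forall>p. degree p > 0 \<and> (\<forall>i. coeff p i \<in> A) \<longrightarrow> (\<exists>a\<in>A. poly p a = 0))"

text \<open>
  The type \<open>'c\<close>, with the embedding \<open>emb\<close> of \<open>K\<close>, is a completion of the algebraic closure \<open>A\<close>
  of \<open>K\<close>.  The absolute value of \<open>u\<close> is \<open>dist u 0\<close>, so that the topology, limits and series of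
  \<open>'c\<close> are those of the type class; completeness is the class \<^class>\<open>complete_space\<close>.
\<close>

locale completed_algebraic_closure =
  fixes emb :: "'a::{field,finite} fls \<Rightarrow> 'c::{field,complete_space}"
    and A :: "'c set"
  assumes emb_one: "emb 1 = 1"
    and emb_add: "emb (y + z) = emb y + emb z"
    and emb_mult: "emb (y * z) = emb y * emb z"
    and dist_conv_abs: "\<And>u v :: 'c. dist u v = dist (u - v) 0"
    and abs_mult: "\<And>u v :: 'c. dist (u * v) 0 = dist u 0 * dist v 0"
    and abs_ultrametric: "\<And>u v :: 'c. dist (u + v) 0 \<le> max (dist u 0) (dist v 0)"
    and abs_extends: "dist (emb z) 0 = fls_abs z"
    and algebraic_closure: "algebraic_closure_in emb A"
    and dense: "closure A = UNIV"

text \<open>Functions on \<open>O\<close> are represented extensionally, i.e. as \<^const>\<open>undefined\<close> outside of \<open>O\<close>.\<close>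

definition C0 :: "('a::{field,finite} fls \<Rightarrow> 'c::{field,complete_space}) \<Rightarrow> ('a fls \<Rightarrow> 'c) set" where
  "C0 emb = {u \<in> int_ring \<rightarrow>\<^sub>E UNIV.
     continuous_on int_ring u \<and>
     (\<forall>s\<in>int_ring. \<forall>t\<in>int_ring. u (s + t) = u s + u t) \<and>
     (\<forall>\<alpha>. \<forall>t\<in>int_ring. u (fls_const \<alpha> * t) = emb (fls_const \<alpha>) * u t)}"

definition C01 :: "('a::{field,finite} fls \<Rightarrow> 'c::{field,complete_space}) \<Rightarrow> ('a fls \<Rightarrow> 'c) set" where
  "C01 emb = {u \<in> C0 emb. \<exists>v. continuous_on int_ring v \<and>
     (\<forall>t\<in>int_ring - {0}. v t = u t / emb t)}"

definition indefinite_sum ::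
    "('a::{field,finite} fls \<Rightarrow> 'c::{field,complete_space}) \<Rightarrow> ('a fls \<Rightarrow> 'c) \<Rightarrow> 'a fls \<Rightarrow> 'c" where
  "indefinite_sum emb f = (THE u. u \<in> C0 emb \<and>
     (\<forall>t\<in>int_ring. u (fls_X * t) - emb fls_X * u t = f t ^ CARD('a)) \<and> u 1 = 0)"

text \<open>
  The integral has no specified value outside of its domain \<^const>\<open>C01\<close>, and none when the limit
  fails to exist.
\<close>

definition volkenborn_integral ::
    "('a::{field,finite} fls \<Rightarrow> 'c::{field,complete_space}) \<Rightarrow> ('a fls \<Rightarrow> 'c) \<Rightarrow> 'c" where
  "volkenborn_integral emb f =
     (if f \<in> C01 emb
      then lim (\<lambda>n. indefinite_sum emb f (fls_X ^ n) / emb (fls_X ^ n))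
      else undefined)"

definition carlitz_bracket :: "nat \<Rightarrow> 'a::{field,finite} fls" where
  "carlitz_bracket i = fls_X ^ (CARD('a) ^ i) - fls_X"

definition carlitz_D :: "nat \<Rightarrow> 'a::{field,finite} fls" where
  "carlitz_D i = (\<Prod>j=1..i. carlitz_bracket j ^ (CARD('a) ^ (i - j)))"

definition carlitz_L :: "nat \<Rightarrow> 'a::{field,finite} fls" where
  "carlitz_L i = (\<Prod>j=1..i. carlitz_bracket j)"

text \<open>For \<open>i \<ge> 1\<close> the index set contains \<open>m = 0\<close>, since \<open>degree 0 = 0\<close> in the library.\<close>

definition carlitz_e :: "nat \<Rightarrow> 'a::{field,finite} fls \<Rightarrow> 'a fls" where
  "carlitz_e i t = (if i = 0 then t
     else \<Prod>m\<in>{m :: 'a poly. degree m < i}. t - fps_to_fls (fps_of_poly m))"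

lemma finite_carlitz_index: "finite {m :: 'a::{field,finite} poly. degree m < i}"
proof (rule finite_subset)
  show "{m :: 'a poly. degree m < i} \<subseteq> Poly ` {xs. set xs \<subseteq> UNIV \<and> length xs \<le> i}"
  proof
    fix m :: "'a poly" assume "m \<in> {m. degree m < i}"
    then have "length (coeffs m) \<le> i"
      by (cases "m = 0") (auto simp: length_coeffs_degree)
    then show "m \<in> Poly ` {xs. set xs \<subseteq> UNIV \<and> length xs \<le> i}"
      by (intro image_eqI[of _ _ "coeffs m"]) auto
  qed
  show "finite (Poly ` {xs :: 'a list. set xs \<subseteq> UNIV \<and> length xs \<le> i})"
    by (intro finite_imageI finite_lists_length_le) simp
qed

definition carlitz_f :: "nat \<Rightarrow> 'a::{field,finite} fls \<Rightarrow> 'a fls" where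
  "carlitz_f i t = carlitz_e i t / carlitz_D i"

definition carlitz_module ::
    "('a::{field,finite} fls \<Rightarrow> 'c::{field,complete_space}) \<Rightarrow> 'a fls \<Rightarrow> 'a fls \<Rightarrow> 'c" where
  "carlitz_module emb s z = (\<Sum>i. emb (carlitz_f i s) * emb z ^ (CARD('a) ^ i))"

definition carlitz_log ::
    "('a::{field,finite} fls \<Rightarrow> 'c::{field,complete_space}) \<Rightarrow> 'a fls \<Rightarrow> 'c" where
  "carlitz_log emb z = (\<Sum>n. (- 1) ^ n * emb z ^ (CARD('a) ^ n) / emb (carlitz_L n))"

end

theory Submission
  imports Defs
begin

text \<open>
  The normalized Carlitz polynomials satisfy \<open>f\<^sub>i\<^sub>+\<^sub>1 = (f\<^sub>i\<^sup>q - f\<^sub>i) / [i + 1]\<close>, from which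
  \<open>f\<^sub>i\<^sub>+\<^sub>1 (x t) - x f\<^sub>i\<^sub>+\<^sub>1 (t) = f\<^sub>i (t)\<^sup>q\<close> follows by induction; hence the indefinite sum of
  \<open>\<Sum> w\<^sub>i f\<^sub>i\<close> is \<open>\<Sum> w\<^sub>i\<^sup>q f\<^sub>i\<^sub>+\<^sub>1\<close>.  Dividing the recursion by \<open>t\<close> gives both
  \<open>f\<^sub>i' (0) = (-1)\<^sup>i / L\<^sub>i\<close> and \<open>\<bar>f\<^sub>i (t) / t\<bar> \<le> q\<^sup>i\<close> on \<open>O\<close>, because \<open>\<bar>[i + 1]\<bar> = 1 / q\<close> and
  \<open>\<bar>f\<^sub>i (t)\<bar> \<le> 1\<close>.  So if \<open>q\<^sup>i \<bar>w\<^sub>i\<bar>\<close> tends to \<open>0\<close>, then the series may be differentiated term by term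
  at \<open>0\<close>, and the integral of \<open>\<Sum> w\<^sub>i f\<^sub>i\<close> is \<open>\<Sum> (-1)\<^sup>i\<^sup>+\<^sup>1 w\<^sub>i\<^sup>q / L\<^sub>i\<^sub>+\<^sub>1\<close>.  Parts (ii) and (iii) are the cases
  \<open>w\<^sub>i = \<delta>\<^sub>i\<^sub>n\<close> and \<open>w\<^sub>i = z\<close> to the power \<open>q\<^sup>i\<close>; in part (i) the indefinite sum is
  \<open>(t\<^sup>Q - t) / [n + 1]\<close> with \<open>Q = q\<^sup>n\<^sup>+\<^sup>1\<close>.
\<close>

section \<open>The \<open>q\<close>-power map on the finite field and on \<open>K\<close>\<close>

lemma card_field_gt_1: "CARD('a::{field,finite}) > 1"
proof -
  have "card {0, 1 :: 'a} \<le> CARD('a)"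
    by (rule card_mono) auto
  then show ?thesis by simp
qed

text \<open>Multiplication by a nonzero \<open>c\<close> permutes the nonzero elements, so comparing
  products over them gives \<open>c ^ (q - 1) = 1\<close>.\<close>

lemma power_card_eq_same:
  fixes c :: "'a::{field,finite}"
  shows "c ^ CARD('a) = c"
proof (cases "c = 0")
  case False
  have "bij_betw ((*) c) (UNIV - {0}) (UNIV - {0})"
    using False by (intro bij_betwI[where g = "\<lambda>y. y / c"]) auto
  then have "(\<Prod>y\<in>UNIV - {0}. c * y) = \<Prod>(UNIV - {0})"
    by (rule prod.reindex_bij_betw)
  then have "c ^ (CARD('a) - 1) = 1"
    by (simp add: prod.distrib card_Diff_singleton)
  then show ?thesis
    using power_Suc[of c "CARD('a) - 1"] by simp
qed (use card_field_gt_1[where 'a = 'a] in simp)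

text \<open>
  The polynomial \<open>\<Sum> 0 < k < q. binomial q k * X ^ k\<close> over the field with \<open>q\<close> elements vanishes
  everywhere and has degree less than \<open>q\<close>.
\<close>

lemma of_nat_card_choose_eq_0:
  assumes "0 < k" "k < CARD('a)"
  shows "of_nat (CARD('a) choose k) = (0 :: 'a::{field,finite})"
proof -
  let ?q = "CARD('a)"
  define p :: "'a poly" where "p = (\<Sum>j\<in>{0<..<?q}. monom (of_nat (?q choose j)) j)"
  have "poly p c = 0" for c
  proof -
    have "{..?q} = insert 0 (insert ?q {0<..<?q})"
      using card_field_gt_1[where 'a = 'a] by auto
    then have "(c + 1) ^ ?q = 1 + c ^ ?q + poly p c"
      using card_field_gt_1[where 'a = 'a]
      by (subst binomial_ring) (simp add: p_def poly_sum poly_monom algebra_simps)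
    then show ?thesis
      by (simp add: power_card_eq_same)
  qed
  moreover have "degree p < ?q"
    unfolding p_def using card_field_gt_1[where 'a = 'a]
    by (intro degree_sum_less) (auto intro: le_less_trans[OF degree_monom_le])
  ultimately have "p = 0"
    using card_field_gt_1[where 'a = 'a] by (intro poly_eqI_degree[of UNIV]) auto
  moreover have "coeff p k = of_nat (?q choose k)"
    using assms by (simp add: p_def coeff_sum if_distrib[of _ _ 0] sum.delta cong: if_cong)
  ultimately show ?thesis by simp
qed

text \<open>Stated for a general semiring because it is applied both in \<open>'a fls\<close> and in
  \<open>'c\<close>.\<close>

lemma add_power_of_choose_eq_0:
  fixes a b :: "'r::comm_semiring_1"
  assumes "n > 0" and "\<And>k. 0 < k \<Longrightarrow> k < n \<Longrightarrow> of_nat (n choose k) = (0 :: 'r)"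
  shows "(a + b) ^ n = a ^ n + b ^ n"
proof -
  have "{..n} = insert 0 (insert n {0<..<n})"
    using assms(1) by auto
  then show ?thesis
    using assms by (simp add: binomial_ring add.commute)
qed

lemma fls_add_power_card:
  fixes a b :: "'a::{field,finite} fls"
  shows "(a + b) ^ CARD('a) = a ^ CARD('a) + b ^ CARD('a)"
proof (rule add_power_of_choose_eq_0)
  fix k assume "0 < k" "k < CARD('a)"
  then show "of_nat (CARD('a) choose k) = (0 :: 'a fls)"
    by (metis fls_of_nat of_nat_card_choose_eq_0 fls_const_0)
qed (use card_field_gt_1[where 'a = 'a] in simp)

lemma fls_diff_power_card:
  fixes a b :: "'a::{field,finite} fls"
  shows "(a - b) ^ CARD('a) = a ^ CARD('a) - b ^ CARD('a)"
  using fls_add_power_card[of "a - b" b] by simp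

lemma fls_const_power_card: "fls_const c ^ CARD('a) = fls_const (c :: 'a::{field,finite})"
  by (metis fls_const_power power_card_eq_same)

text \<open>Both sides are monic of degree \<open>q\<close> in \<open>t\<close> and agree at the
  \<open>q\<close> constants, hence they coincide.\<close>

lemma prod_diff_fls_const:
  fixes t :: "'a::{field,finite} fls"
  shows "(\<Prod>c\<in>UNIV. t - fls_const c) = t ^ CARD('a) - t"
proof -
  let ?q = "CARD('a)"
  define p :: "'a fls poly" where "p = (\<Prod>c\<in>UNIV. [:- fls_const c, 1:])"
  define r :: "'a fls poly" where "r = monom 1 ?q - monom 1 1"
  have deg_p: "degree p = ?q"
    by (simp add: p_def degree_prod_eq_sum_degree)
  have lead_p: "lead_coeff p = 1"
    unfolding p_def lead_coeff_prod by simp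
  have deg_r: "degree r = ?q"
    unfolding r_def using card_field_gt_1[where 'a = 'a]
    by (subst diff_conv_add_uminus, subst degree_add_eq_left)
       (auto simp: degree_monom_eq)
  have "p = r"
  proof (rule poly_eqI_degree_lead_coeff)
    show "coeff p ?q = coeff r ?q"
      using lead_p deg_p card_field_gt_1[where 'a = 'a] by (simp add: r_def)
    show "?q \<le> card (range (fls_const :: 'a \<Rightarrow> 'a fls))"
      by (subst card_image) (auto intro!: injI dest: fun_cong simp: fls_eq_iff split: if_splits)
    show "poly p z = poly r z" if "z \<in> range fls_const" for z
      using that card_field_gt_1[where 'a = 'a]
      by (auto simp: p_def r_def poly_prod poly_monom fls_const_power_card)
  qed (simp_all add: deg_p deg_r)
  then have "poly p t = poly r t" by simp
  then show ?thesis
    by (simp add: p_def r_def poly_prod poly_monom)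
qed

text \<open>Homogeneous form of the preceding identity, obtained by substituting
  \<open>t / s\<close>; it is applied with \<open>s = carlitz_D i\<close>.\<close>

lemma prod_diff_fls_const_mult:
  fixes s t :: "'a::{field,finite} fls"
  assumes "s \<noteq> 0"
  shows "(\<Prod>c\<in>UNIV. t - fls_const c * s) = t ^ CARD('a) - s ^ (CARD('a) - 1) * t"
proof -
  have "(\<Prod>c\<in>UNIV. t - fls_const c * s) = (\<Prod>c\<in>UNIV. s * (t / s - fls_const c))"
    using assms by (intro prod.cong) (auto simp: field_simps)
  also have "\<dots> = s ^ CARD('a) * ((t / s) ^ CARD('a) - t / s)"
    by (simp add: prod.distrib prod_diff_fls_const)
  also have "\<dots> = t ^ CARD('a) - s ^ (CARD('a) - 1) * t"
    using assms power_Suc[of s "CARD('a) - 1"]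
    by (simp add: power_divide right_diff_distrib)
  finally show ?thesis .
qed

section \<open>Brackets and the products \<open>D\<close> and \<open>L\<close>\<close>

lemma fls_subdegree_carlitz_bracket:
  assumes "i > 0"
  shows "fls_subdegree (carlitz_bracket i :: 'a::{field,finite} fls) = 1"
proof -
  have "1 < CARD('a) ^ i"
    using card_field_gt_1[where 'a = 'a] assms by (rule one_less_power)
  then show ?thesis
    by (intro fls_subdegree_eqI) (use assms in \<open>auto simp: carlitz_bracket_def simp flip: of_nat_power\<close>)
qed

lemma carlitz_bracket_nonzero: "i > 0 \<Longrightarrow> carlitz_bracket i \<noteq> (0 :: 'a::{field,finite} fls)"
  using fls_subdegree_carlitz_bracket[of i, where 'a = 'a] by auto

lemma carlitz_bracket_power_card:
  "carlitz_bracket i ^ CARD('a) = fls_X ^ CARD('a) ^ Suc i - (fls_X :: 'a::{field,finite} fls) ^ CARD('a)"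
  by (simp add: carlitz_bracket_def fls_diff_power_card mult.commute flip: power_mult)

lemma carlitz_D_0 [simp]: "carlitz_D 0 = 1"
  by (simp add: carlitz_D_def)

lemma carlitz_D_Suc:
  "carlitz_D (Suc i) = carlitz_bracket (Suc i) * (carlitz_D i :: 'a::{field,finite} fls) ^ CARD('a)"
proof -
  have "(\<Prod>j=1..i. carlitz_bracket j ^ CARD('a) ^ (Suc i - j)) = (carlitz_D i :: 'a fls) ^ CARD('a)"
    unfolding carlitz_D_def prod_power_distrib
    by (intro prod.cong) (auto simp: Suc_diff_le mult.commute simp flip: power_mult)
  then show ?thesis
    by (simp add: carlitz_D_def[of "Suc i"] mult.commute)
qed

lemma carlitz_D_nonzero: "carlitz_D i \<noteq> (0 :: 'a::{field,finite} fls)"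
  by (induction i) (auto simp: carlitz_D_Suc carlitz_bracket_nonzero)

lemma carlitz_L_0 [simp]: "carlitz_L 0 = 1"
  by (simp add: carlitz_L_def)

lemma carlitz_L_Suc: "carlitz_L (Suc i) = carlitz_bracket (Suc i) * carlitz_L i"
  by (simp add: carlitz_L_def mult.commute)

subsection \<open>Recursion for the normalized Carlitz polynomials\<close>

text \<open>These are the normalized Carlitz polynomials, as \<open>carlitz_f_eq_rec\<close> shows.
  Starting from the recursion makes linearity and the shift identity accessible to induction before
  the product formula is treated.\<close>

primrec carlitz_rec :: "nat \<Rightarrow> 'a::{field,finite} fls \<Rightarrow> 'a fls" where
  "carlitz_rec 0 t = t"
| "carlitz_rec (Suc i) t =
     (carlitz_rec i t ^ CARD('a) - carlitz_rec i t) / carlitz_bracket (Suc i)"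

lemma carlitz_rec_add: "carlitz_rec i (s + t) = carlitz_rec i s + carlitz_rec i t"
  by (induction i) (simp_all add: fls_add_power_card diff_divide_distrib add_divide_distrib)

lemma carlitz_rec_const: "carlitz_rec i (fls_const c * t) = fls_const c * carlitz_rec i t"
  by (induction i) (simp_all add: power_mult_distrib fls_const_power_card flip: right_diff_distrib)

lemma carlitz_rec_diff: "carlitz_rec i (s - t) = carlitz_rec i s - carlitz_rec i t"
  using carlitz_rec_add[of i "s - t" t] by simp

lemma carlitz_rec_Suc_shift:
  fixes t :: "'a::{field,finite} fls"
  shows "carlitz_rec (Suc i) (fls_X * t) = fls_X * carlitz_rec (Suc i) t + carlitz_rec i t ^ CARD('a)"
proof (induction i)
  case 0
  have "carlitz_bracket (Suc 0) \<noteq> (0 :: 'a fls)"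
    by (simp add: carlitz_bracket_nonzero)
  then show ?case
    by (simp add: field_simps) (simp add: carlitz_bracket_def algebra_simps power_mult_distrib)
next
  case (Suc i)
  let ?q = "CARD('a)" and ?f = "carlitz_rec i t" and ?g = "carlitz_rec (Suc i) t"
  have ne: "carlitz_bracket (Suc i) \<noteq> (0 :: 'a fls)" "carlitz_bracket (Suc (Suc i)) \<noteq> (0 :: 'a fls)"
    by (simp_all add: carlitz_bracket_nonzero)
  have "?f ^ ?q - ?f = carlitz_bracket (Suc i) * ?g"
    using ne by simp
  then have "(?f ^ ?q) ^ ?q - ?f ^ ?q = carlitz_bracket (Suc i) ^ ?q * ?g ^ ?q"
    by (metis fls_diff_power_card power_mult_distrib)
  \<comment> \<open>The recursion raised to the power \<open>q\<close> eliminates the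
    \<open>q^2\<close>-th power of \<open>?f\<close>; below, its term \<open>- x^q * ?g ^ ?q\<close>
    cancels the one coming from \<open>(x * ?g) ^ ?q\<close>.\<close>
  then have *: "(?f ^ ?q) ^ ?q = ?f ^ ?q + (fls_X ^ ?q ^ Suc (Suc i) - fls_X ^ ?q) * ?g ^ ?q"
    by (simp only: carlitz_bracket_power_card) (simp add: algebra_simps)
  have "carlitz_rec (Suc (Suc i)) (fls_X * t) =
     ((fls_X * ?g + ?f ^ ?q) ^ ?q - (fls_X * ?g + ?f ^ ?q)) / carlitz_bracket (Suc (Suc i))"
    unfolding carlitz_rec.simps(2)[of "Suc i"] Suc.IH ..
  also have "(fls_X * ?g + ?f ^ ?q) ^ ?q - (fls_X * ?g + ?f ^ ?q) =
      fls_X * (?g ^ ?q - ?g) + carlitz_bracket (Suc (Suc i)) * ?g ^ ?q"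
    unfolding fls_add_power_card * power_mult_distrib
    by (simp add: carlitz_bracket_def algebra_simps)
  also have "\<dots> / carlitz_bracket (Suc (Suc i)) =
      fls_X * carlitz_rec (Suc (Suc i)) t + ?g ^ ?q"
    unfolding carlitz_rec.simps(2)[of "Suc i"] using ne(2) by (simp add: add_divide_distrib)
  finally show ?case .
qed

section \<open>Special values and comparison with the product definition\<close>

lemma carlitz_rec_Suc_one: "carlitz_rec (Suc i) 1 = 0"
  using card_field_gt_1[where 'a = 'a] by (induction i) auto

text \<open>If \<open>f_i (x^i) = 1\<close>, the recursion gives \<open>f_(i+1) (x^i) = 0\<close>,
  and the shift identity then gives \<open>f_(i+1) (x^(i+1)) = 1\<close>. This normalization is what
  identifies \<open>D_i\<close> with \<open>e_i (x^i)\<close>.\<close>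

lemma carlitz_rec_X_power: "carlitz_rec i (fls_X ^ i) = (1 :: 'a::{field,finite} fls)"
proof (induction i)
  case (Suc i)
  then have "carlitz_rec (Suc i) (fls_X ^ i) = (0 :: 'a fls)"
    by simp
  with Suc show ?case
    unfolding power_Suc carlitz_rec_Suc_shift by simp
qed simp

text \<open>Bounding the support instead of the degree leaves exactly \<open>m = 0\<close> for
  \<open>i = 0\<close>, so that the case distinction in \<open>carlitz_e\<close> disappears.\<close>

lemma carlitz_e_eq_prod:
  fixes t :: "'a::{field,finite} fls"
  shows "carlitz_e i t = (\<Prod>m | \<forall>k. coeff m k \<noteq> 0 \<longrightarrow> k < i. t - fps_to_fls (fps_of_poly m))"
proof (cases "i = 0")
  case True
  then have "{m :: 'a poly. \<forall>k. coeff m k \<noteq> 0 \<longrightarrow> k < i} = {0}"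
    by (auto simp: poly_eq_iff)
  then show ?thesis
    using True by (simp add: carlitz_e_def)
next
  case False
  then have "degree m < i \<longleftrightarrow> (\<forall>k. coeff m k \<noteq> 0 \<longrightarrow> k < i)" for m :: "'a poly"
    using leading_coeff_0_iff[of m] by (cases "m = 0") (auto dest: le_degree)
  then show ?thesis
    using False by (simp add: carlitz_e_def)
qed

text \<open>A polynomial supported below \<open>i + 1\<close> splits uniquely into its term
  \<open>c * x^i\<close> and a polynomial supported below \<open>i\<close>.\<close>

lemma carlitz_e_Suc:
  fixes t :: "'a::{field,finite} fls"
  shows "carlitz_e (Suc i) t = (\<Prod>c\<in>UNIV. carlitz_e i (t - fls_const c * fls_X ^ i))"
proof -
  let ?M = "\<lambda>i. {m :: 'a poly. \<forall>k. coeff m k \<noteq> 0 \<longrightarrow> k < i}"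
  have "(\<Prod>c\<in>UNIV. carlitz_e i (t - fls_const c * fls_X ^ i)) =
    (\<Prod>(c, m)\<in>UNIV \<times> ?M i. t - fls_const c * fls_X ^ i - fps_to_fls (fps_of_poly m))"
    by (simp add: carlitz_e_eq_prod prod.cartesian_product)
  also have "\<dots> = (\<Prod>m\<in>?M (Suc i). t - fps_to_fls (fps_of_poly m))"
    by (rule prod.reindex_bij_witness[of _ "\<lambda>m. (coeff m i, m - monom (coeff m i) i)"
          "\<lambda>(c, m). monom c i + m"])
       (auto simp: less_Suc_eq fps_of_poly_add fps_of_poly_monom fls_times_fps_to_fls
         fps_to_fls_power algebra_simps split: if_splits)
  finally show ?thesis by (simp add: carlitz_e_eq_prod)
qed

text \<open>By linearity and \<open>f_i (x^i) = 1\<close>, the factors in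
  \<open>carlitz_e_Suc\<close> become \<open>D_i * f_i (t) - c * D_i\<close>, and their product over
  \<open>c\<close> is known.\<close>

lemma carlitz_e_eq_rec:
  fixes t :: "'a::{field,finite} fls"
  shows "carlitz_e i t = carlitz_D i * carlitz_rec i t"
proof (induction i arbitrary: t)
  case 0
  show ?case by (simp add: carlitz_e_def)
next
  case (Suc i)
  let ?q = "CARD('a)" and ?D = "carlitz_D i :: 'a fls" and ?f = "carlitz_rec i t"
  have "carlitz_e (Suc i) t = (\<Prod>c\<in>UNIV. ?D * ?f - fls_const c * ?D)"
    unfolding carlitz_e_Suc Suc.IH
    by (simp add: carlitz_rec_diff carlitz_rec_const carlitz_rec_X_power algebra_simps)
  also have "\<dots> = ?D ^ ?q * (?f ^ ?q - ?f)"
    using power_Suc[of ?D "?q - 1"]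
    by (simp add: prod_diff_fls_const_mult carlitz_D_nonzero power_mult_distrib right_diff_distrib)
  also have "\<dots> = carlitz_D (Suc i) * carlitz_rec (Suc i) t"
    using carlitz_bracket_nonzero[of "Suc i", where 'a = 'a] by (simp add: carlitz_D_Suc)
  finally show ?case .
qed

lemma carlitz_f_eq_rec: "carlitz_f i t = carlitz_rec i t"
  by (simp add: carlitz_f_def carlitz_e_eq_rec carlitz_D_nonzero)

lemma carlitz_f_0 [simp]: "carlitz_f 0 t = t"
  by (simp add: carlitz_f_eq_rec)

lemma carlitz_f_Suc:
  fixes t :: "'a::{field,finite} fls"
  shows "carlitz_f (Suc i) t = (carlitz_f i t ^ CARD('a) - carlitz_f i t) / carlitz_bracket (Suc i)"
  by (simp add: carlitz_f_eq_rec)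

lemma carlitz_f_add: "carlitz_f i (s + t) = carlitz_f i s + carlitz_f i t"
  by (simp only: carlitz_f_eq_rec carlitz_rec_add)

lemma carlitz_f_const_mult: "carlitz_f i (fls_const c * t) = fls_const c * carlitz_f i t"
  by (simp only: carlitz_f_eq_rec carlitz_rec_const)

lemma carlitz_f_Suc_1: "carlitz_f (Suc i) 1 = 0"
  by (simp only: carlitz_f_eq_rec carlitz_rec_Suc_one)

lemma carlitz_f_Suc_X_mult:
  fixes t :: "'a::{field,finite} fls"
  shows "carlitz_f (Suc i) (fls_X * t) = fls_X * carlitz_f (Suc i) t + carlitz_f i t ^ CARD('a)"
  by (simp only: carlitz_f_eq_rec carlitz_rec_Suc_shift)

subsection \<open>The ring of integers\<close>

lemma int_ring_iff_subdegree:
  "z \<in> int_ring \<longleftrightarrow> fls_subdegree (z :: 'a::{field,finite} fls) \<ge> 0"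
proof (cases "z = 0")
  case False
  have "real CARD('a) > 1"
    using card_field_gt_1[where 'a = 'a] by simp
  then have "real CARD('a) powi a \<le> 1 \<longleftrightarrow> a \<le> 0" for a
    using power_int_strict_increasing[of 0 a "real CARD('a)"]
      power_int_increasing[of a 0 "real CARD('a)"]
    by (cases "a \<le> 0") auto
  then show ?thesis
    using False by (simp add: int_ring_def fls_abs_def)
qed (simp add: int_ring_def fls_abs_def)

lemma int_ring_eq_range: "int_ring = range fps_to_fls"
proof safe
  fix z :: "'a fls" assume "z \<in> int_ring"
  then have "z = fps_to_fls (fls_regpart z)"
    by (simp add: int_ring_iff_subdegree)
  then show "z \<in> range fps_to_fls" by blast
qed (simp add: int_ring_iff_subdegree fls_subdegree_fls_to_fps_gt0)

lemma int_ring_0 [simp]: "0 \<in> int_ring"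
  and int_ring_1 [simp]: "1 \<in> int_ring"
  and int_ring_fls_X [simp]: "fls_X \<in> int_ring"
  and int_ring_fls_const [simp]: "fls_const c \<in> int_ring"
  by (simp_all add: int_ring_iff_subdegree)

lemma int_ring_add [intro]: "y \<in> int_ring \<Longrightarrow> z \<in> int_ring \<Longrightarrow> y + z \<in> int_ring"
  unfolding int_ring_eq_range by (auto simp flip: fps_to_fls_plus)

lemma int_ring_diff [intro]: "y \<in> int_ring \<Longrightarrow> z \<in> int_ring \<Longrightarrow> y - z \<in> int_ring"
  unfolding int_ring_eq_range by (auto simp flip: fps_to_fls_minus)

lemma int_ring_mult [intro]: "y \<in> int_ring \<Longrightarrow> z \<in> int_ring \<Longrightarrow> y * z \<in> int_ring"
  unfolding int_ring_eq_range by (auto simp flip: fls_times_fps_to_fls)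

lemma int_ring_power [intro]: "z \<in> int_ring \<Longrightarrow> z ^ n \<in> int_ring"
  by (induction n) auto

lemma int_ring_decompose:
  assumes "t \<in> int_ring"
  obtains c s where "s \<in> int_ring" "t = fls_const c + fls_X * s"
proof -
  obtain f where t: "t = fps_to_fls f"
    using assms by (auto simp: int_ring_eq_range)
  have "f = fps_const (fps_nth f 0) + fps_X * fps_shift 1 f"
    by (simp add: fps_eq_iff)
  then have "t = fls_const (fps_nth f 0) + fls_X * fps_to_fls (fps_shift 1 f)"
    unfolding t by (metis fls_times_fps_to_fls fps_X_to_fls fps_const_to_fls fps_to_fls_plus)
  then show ?thesis
    by (intro that) (auto simp: int_ring_eq_range)
qed

text \<open>
  A priori \<open>f\<^sub>i\<^sub>+\<^sub>1\<close> maps \<open>O\<close> to \<open>x\<^sup>-\<^sup>1 O\<close>.  Since \<open>f\<^sub>i\<^sub>+\<^sub>1 (c + x s) = x f\<^sub>i\<^sub>+\<^sub>1 (s) + f\<^sub>i (s)\<^sup>q\<close>, the factor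
  \<open>x\<^sup>-\<^sup>1\<close> is absorbed.
\<close>

lemma carlitz_f_int_ring:
  fixes t :: "'a::{field,finite} fls"
  assumes "t \<in> int_ring"
  shows "carlitz_f i t \<in> int_ring"
  using assms
proof (induction i arbitrary: t)
  case (Suc i)
  let ?b = "carlitz_bracket (Suc i) :: 'a fls"
  have "?b \<noteq> 0" "fls_subdegree ?b = 1"
    by (simp_all add: carlitz_bracket_nonzero fls_subdegree_carlitz_bracket)
  then have "fls_X / ?b \<in> int_ring"
    by (simp add: int_ring_iff_subdegree fls_divide_subdegree)
  then have *: "fls_X * carlitz_f (Suc i) s \<in> int_ring" if "s \<in> int_ring" for s :: "'a fls"
    using int_ring_mult[of "fls_X / ?b" "carlitz_f i s ^ CARD('a) - carlitz_f i s"] Suc.IH[OF that]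
    by (auto simp: carlitz_f_Suc)
  obtain c s where s: "s \<in> int_ring" "t = fls_const c + fls_X * s"
    using int_ring_decompose[OF Suc.prems] .
  have "carlitz_f (Suc i) (fls_const c) = 0"
    using carlitz_f_const_mult[of "Suc i" c 1] by (simp add: carlitz_f_Suc_1)
  then have "carlitz_f (Suc i) t = fls_X * carlitz_f (Suc i) s + carlitz_f i s ^ CARD('a)"
    unfolding s(2) carlitz_f_add carlitz_f_Suc_X_mult by simp
  then show ?case
    using * Suc.IH s(1) by auto
qed simp

text \<open>The function \<open>f\<^sub>i (t) / t\<close>, extended to \<open>t = 0\<close> by the value \<open>f\<^sub>i' (0)\<close>.\<close>

primrec carlitz_slope :: "nat \<Rightarrow> 'a::{field,finite} fls \<Rightarrow> 'a fls" where
  "carlitz_slope 0 t = 1"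
| "carlitz_slope (Suc i) t =
     carlitz_slope i t * ((carlitz_f i t ^ (CARD('a) - 1) - 1) / carlitz_bracket (Suc i))"

lemma carlitz_f_eq_slope:
  fixes t :: "'a::{field,finite} fls"
  shows "carlitz_f i t = t * carlitz_slope i t"
proof (induction i)
  case (Suc i)
  let ?f = "carlitz_f i t"
  have "?f ^ CARD('a) - ?f = ?f * (?f ^ (CARD('a) - 1) - 1)"
    using power_Suc[of ?f "CARD('a) - 1"] by (simp add: right_diff_distrib)
  then show ?case
    using Suc by (simp add: carlitz_f_Suc)
qed simp

text \<open>Since \<open>f_i (0) = 0\<close> and \<open>q - 1 > 0\<close>, each new factor at
  \<open>0\<close> is \<open>- 1 / [i + 1]\<close>.\<close>

lemma carlitz_slope_0: "carlitz_slope i 0 = (- 1) ^ i / (carlitz_L i :: 'a::{field,finite} fls)"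
proof (induction i)
  case (Suc i)
  have "carlitz_f i 0 = (0 :: 'a fls)"
    by (simp add: carlitz_f_eq_slope)
  then show ?case
    using Suc card_field_gt_1[where 'a = 'a]
    by (simp add: carlitz_L_Suc power_0_left mult.commute)
qed simp

subsection \<open>Series of Carlitz polynomials\<close>

definition carlitz_series ::
    "('a::{field,finite} fls \<Rightarrow> 'c::{field,complete_space}) \<Rightarrow> (nat \<Rightarrow> 'c) \<Rightarrow> 'a fls \<Rightarrow> 'c" where
  "carlitz_series emb w s = (\<Sum>i. emb (carlitz_f i s) * w i)"

definition carlitz_slope_series ::
    "('a::{field,finite} fls \<Rightarrow> 'c::{field,complete_space}) \<Rightarrow> (nat \<Rightarrow> 'c) \<Rightarrow> 'a fls \<Rightarrow> 'c" where
  "carlitz_slope_series emb w s = (\<Sum>i. emb (carlitz_slope i s) * w i)"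

subsection \<open>Analysis in the completed algebraic closure\<close>

context completed_algebraic_closure
begin

section \<open>Algebra of the embedding and of the absolute value\<close>

lemma emb_0 [simp]: "emb 0 = 0"
  by (metis add_0 add_cancel_right_right emb_add)

lemma emb_diff: "emb (y - z) = emb y - emb z"
  using emb_add[of "y - z" z] by simp

lemma emb_minus: "emb (- z) = - emb z"
  using emb_diff[of 0 z] by simp

lemma emb_power: "emb (z ^ n) = emb z ^ n"
  by (induction n) (simp_all add: emb_one emb_mult)

lemma emb_of_nat: "emb (of_nat n) = of_nat n"
  by (induction n) (simp_all add: emb_one emb_add)

lemma emb_eq_0_iff [simp]: "emb z = 0 \<longleftrightarrow> z = 0"
proof
  assume "emb z = 0"
  then have "emb (z * inverse z) = 0" by (simp add: emb_mult)
  then show "z = 0" by (cases "z = 0") (auto simp: emb_one)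
qed simp

lemma emb_divide: "emb (y / z) = emb y / emb z"
proof (cases "z = 0")
  case False
  then have "emb y = emb (y / z) * emb z"
    by (simp flip: emb_mult)
  with False show ?thesis by simp
qed simp

lemma abs_one: "dist (1 :: 'c) 0 = 1"
  using abs_mult[of 1 1] by simp

lemma abs_power: "dist (u ^ n) (0 :: 'c) = dist u 0 ^ n"
  by (induction n) (simp_all add: abs_one abs_mult)

lemma abs_divide: "dist (u / v) (0 :: 'c) = dist u 0 / dist v 0"
proof (cases "v = 0")
  case False
  then have "dist u 0 = dist (u / v) 0 * dist v 0"
    by (simp flip: abs_mult)
  with False show ?thesis by simp
qed simp

lemma abs_sum_less:
  fixes f :: "'i \<Rightarrow> 'c"
  assumes "e > 0" "\<And>i. i \<in> I \<Longrightarrow> dist (f i) 0 < e"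
  shows "dist (sum f I) 0 < e"
  using assms
proof (induction I rule: infinite_finite_induct)
  case (insert i I)
  then show ?case
    using abs_ultrametric[of "f i" "sum f I"] by (force simp: max_def split: if_splits)
qed auto

lemma abs_emb_le_1: "z \<in> int_ring \<Longrightarrow> dist (emb z) 0 \<le> 1"
  by (simp add: abs_extends int_ring_def)

text \<open>
  The type class of \<open>'c\<close> only provides a field and a complete metric, so the continuity of the
  arithmetic operations has to be derived from the locale assumptions.
\<close>

lemma tendsto_dist_leI:
  assumes "\<And>x. dist (f x) l \<le> g x" "(g \<longlongrightarrow> 0) F"
  shows "(f \<longlongrightarrow> l) F"
  unfolding tendsto_dist_iff[of f]
  by (rule tendsto_sandwich[OF _ _ tendsto_const assms(2)]) (auto simp: assms(1))

lemma tendsto_add':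
  fixes f g :: "'x \<Rightarrow> 'c"
  assumes "(f \<longlongrightarrow> a) F" "(g \<longlongrightarrow> b) F"
  shows "((\<lambda>x. f x + g x) \<longlongrightarrow> a + b) F"
proof -
  have "dist (f x + g x) (a + b) \<le> dist (f x) a + dist (g x) b" for x
  proof -
    have "dist (f x + g x) (a + b) \<le> max (dist (f x) a) (dist (g x) b)"
      using abs_ultrametric[of "f x - a" "g x - b"]
      by (simp add: dist_conv_abs[of "f x + g x"] dist_conv_abs[of "f x" a]
          dist_conv_abs[of "g x" b] add_diff_add)
    also have "\<dots> \<le> dist (f x) a + dist (g x) b"
      by simp
    finally show ?thesis .
  qed
  moreover have "((\<lambda>x. dist (f x) a + dist (g x) b) \<longlongrightarrow> 0 + 0) F"
    using assms by (intro tendsto_add) (simp_all only: tendsto_dist_iff[symmetric])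
  ultimately show ?thesis
    by (intro tendsto_dist_leI[of "\<lambda>x. f x + g x"]) auto
qed

lemma tendsto_mult':
  fixes f g :: "'x \<Rightarrow> 'c"
  assumes "(f \<longlongrightarrow> a) F" "(g \<longlongrightarrow> b) F"
  shows "((\<lambda>x. f x * g x) \<longlongrightarrow> a * b) F"
proof -
  have "dist (f x * g x) (a * b) \<le> dist (f x) a * dist (g x) 0 + dist a 0 * dist (g x) b" for x
  proof -
    have "dist (f x * g x) (a * b) = dist ((f x - a) * g x + a * (g x - b)) 0"
      by (subst dist_conv_abs) (simp add: algebra_simps)
    also have "\<dots> \<le> max (dist (f x) a * dist (g x) 0) (dist a 0 * dist (g x) b)"
      using abs_ultrametric[of "(f x - a) * g x" "a * (g x - b)"]
      by (simp add: abs_mult dist_conv_abs[of "f x" a] dist_conv_abs[of "g x" b])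
    also have "\<dots> \<le> dist (f x) a * dist (g x) 0 + dist a 0 * dist (g x) b"
      by simp
    finally show ?thesis .
  qed
  moreover have "((\<lambda>x. dist (f x) a * dist (g x) 0 + dist a 0 * dist (g x) b) \<longlongrightarrow>
      0 * dist b 0 + dist a 0 * 0) F"
    using assms
    by (intro tendsto_add tendsto_mult tendsto_const tendsto_dist)
       (simp_all only: tendsto_dist_iff[symmetric])
  ultimately show ?thesis
    by (intro tendsto_dist_leI[of "\<lambda>x. f x * g x"]) auto
qed

lemma tendsto_diff':
  fixes f g :: "'x \<Rightarrow> 'c"
  assumes "(f \<longlongrightarrow> a) F" "(g \<longlongrightarrow> b) F"
  shows "((\<lambda>x. f x - g x) \<longlongrightarrow> a - b) F"
  using tendsto_add'[OF assms(1) tendsto_mult'[OF tendsto_const[of "- 1"] assms(2)]] by simp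

lemma tendsto_power':
  fixes f :: "'x \<Rightarrow> 'c"
  assumes "(f \<longlongrightarrow> a) F"
  shows "((\<lambda>x. f x ^ n) \<longlongrightarrow> a ^ n) F"
  using assms by (induction n) (simp_all add: tendsto_mult')

lemma tendsto_sum':
  fixes f :: "'i \<Rightarrow> 'x \<Rightarrow> 'c"
  assumes "\<And>i. i \<in> I \<Longrightarrow> (f i \<longlongrightarrow> a i) F"
  shows "((\<lambda>x. \<Sum>i\<in>I. f i x) \<longlongrightarrow> (\<Sum>i\<in>I. a i)) F"
  using assms by (induction I rule: infinite_finite_induct) (simp_all add: tendsto_add')

text \<open>The class metric on \<open>'a fls\<close> has base 2;
  \<open>open_fls_iff_fls_abs\<close> allows convergence to be tested with
  \<open>fls_abs\<close>.\<close>

lemma tendsto_flsI: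
  assumes "((\<lambda>x. fls_abs (f x - a)) \<longlongrightarrow> 0) F"
  shows "(f \<longlongrightarrow> (a :: 'a fls)) F"
proof (rule topological_tendstoI)
  fix U :: "'a fls set" assume "open U" "a \<in> U"
  then obtain e where e: "e > 0" "\<And>b. fls_abs (b - a) < e \<Longrightarrow> b \<in> U"
    unfolding open_fls_iff_fls_abs by blast
  show "eventually (\<lambda>x. f x \<in> U) F"
    using order_tendstoD(2)[OF assms e(1)] by eventually_elim (use e in auto)
qed

text \<open>\<open>emb\<close> preserves \<open>fls_abs\<close>, and by the ultrametric inequality
  the preimage of a ball of radius \<open>e\<close> contains the \<open>e\<close>-ball around each
  of its points, hence is open.\<close>

lemma continuous_on_emb: "continuous_on S emb"
  unfolding continuous_on_def
proof (intro ballI tendstoI)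
  fix a :: "'a fls" and e :: real assume e: "e > 0"
  have abs: "dist (emb y) (emb z) = fls_abs (y - z)" for y z
    by (simp add: dist_conv_abs[of "emb y"] abs_extends flip: emb_diff)
  have "open {b. dist (emb b) (emb a) < e}"
    unfolding open_fls_iff_fls_abs
  proof (intro ballI exI[of _ e] conjI e allI impI)
    fix y b assume "y \<in> {b. dist (emb b) (emb a) < e}" "fls_abs (b - y) < e"
    then have "dist (emb y) (emb a) < e" "dist (emb b) (emb y) < e"
      by (simp_all add: abs)
    moreover have "dist (emb b) (emb a) \<le> max (dist (emb b) (emb y)) (dist (emb y) (emb a))"
      using abs_ultrametric[of "emb b - emb y" "emb y - emb a"]
      by (simp add: dist_conv_abs[of _ "emb a"] dist_conv_abs[of _ "emb y"])
    ultimately show "b \<in> {b. dist (emb b) (emb a) < e}"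
      by simp
  qed
  then show "eventually (\<lambda>b. dist (emb b) (emb a) < e) (at a within S)"
    using e by (auto simp: eventually_at_topological)
qed

lemma continuous_on_add':
  "continuous_on S f \<Longrightarrow> continuous_on S g \<Longrightarrow> continuous_on S (\<lambda>x. f x + g x :: 'c)"
  by (simp add: continuous_on_def tendsto_add')

lemma continuous_on_diff':
  "continuous_on S f \<Longrightarrow> continuous_on S g \<Longrightarrow> continuous_on S (\<lambda>x. f x - g x :: 'c)"
  by (simp add: continuous_on_def tendsto_diff')

lemma continuous_on_mult':
  "continuous_on S f \<Longrightarrow> continuous_on S g \<Longrightarrow> continuous_on S (\<lambda>x. f x * g x :: 'c)"
  by (simp add: continuous_on_def tendsto_mult')

lemma continuous_on_power':
  "continuous_on S f \<Longrightarrow> continuous_on S (\<lambda>x. f x ^ n :: 'c)"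
  by (simp add: continuous_on_def tendsto_power')

lemma continuous_on_sum':
  "(\<And>i. i \<in> I \<Longrightarrow> continuous_on S (f i)) \<Longrightarrow> continuous_on S (\<lambda>x. \<Sum>i\<in>I. f i x :: 'c)"
  by (simp add: continuous_on_def tendsto_sum')

lemma continuous_on_divide_const':
  "continuous_on S f \<Longrightarrow> continuous_on S (\<lambda>x. f x / c :: 'c)"
  unfolding divide_inverse by (intro continuous_on_mult' continuous_on_const)

lemmas continuous_intros' = continuous_on_add' continuous_on_diff' continuous_on_mult'
  continuous_on_power' continuous_on_sum' continuous_on_divide_const' continuous_on_const
  continuous_on_emb

section \<open>Continuity and size of the terms\<close>

lemma continuous_on_emb_carlitz_f: "continuous_on S (\<lambda>t. emb (carlitz_f i t))"
  by (induction i)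
     (auto simp: carlitz_f_Suc emb_divide emb_diff emb_power intro!: continuous_intros')

lemma continuous_on_emb_carlitz_slope: "continuous_on S (\<lambda>t. emb (carlitz_slope i t))"
  by (induction i)
     (auto simp: emb_divide emb_diff emb_power emb_mult emb_one
       intro!: continuous_intros' continuous_on_emb_carlitz_f)

lemma abs_emb_carlitz_slope_le:
  assumes "t \<in> int_ring"
  shows "dist (emb (carlitz_slope i t)) 0 \<le> real CARD('a) ^ i"
proof (induction i)
  case (Suc i)
  have "dist (emb (carlitz_bracket (Suc i))) 0 = 1 / real CARD('a)"
    by (simp add: abs_extends fls_abs_def carlitz_bracket_nonzero fls_subdegree_carlitz_bracket
        field_simps)
  moreover have "dist (emb (carlitz_f i t ^ (CARD('a) - 1) - 1)) 0 \<le> 1"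
    by (intro abs_emb_le_1 int_ring_diff int_ring_power int_ring_1 carlitz_f_int_ring[OF assms])
  ultimately have "dist (emb ((carlitz_f i t ^ (CARD('a) - 1) - 1) / carlitz_bracket (Suc i))) 0
      \<le> real CARD('a)"
    by (simp add: emb_divide abs_divide mult_left_le_one_le)
  from mult_mono[OF Suc this] show ?case
    by (simp only: carlitz_slope.simps emb_mult abs_mult power_Suc2) simp
qed (simp add: emb_one abs_one)

text \<open>The characteristic of \<open>'c\<close> is only known through \<open>emb\<close>, which
  carries the vanishing of the binomial coefficients over from \<open>K\<close>.\<close>

lemma add_power_card:
  fixes a b :: 'c
  shows "(a + b) ^ CARD('a) = a ^ CARD('a) + b ^ CARD('a)"
proof (rule add_power_of_choose_eq_0)
  fix k assume "0 < k" "k < CARD('a)"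
  then have "of_nat (CARD('a) choose k) = (0 :: 'a fls)"
    by (metis fls_of_nat of_nat_card_choose_eq_0 fls_const_0)
  then show "of_nat (CARD('a) choose k) = (0 :: 'c)"
    by (metis emb_0 emb_of_nat)
qed simp

lemma sum_power_card:
  fixes f :: "'i \<Rightarrow> 'c"
  shows "sum f I ^ CARD('a) = (\<Sum>i\<in>I. f i ^ CARD('a))"
  by (induction I rule: infinite_finite_induct) (simp_all add: add_power_card)

text \<open>A finite block of terms is bounded by its largest term, so a null sequence
  \<open>M\<close> already makes the partial sums uniformly Cauchy.\<close>

lemma ultrametric_M_test:
  fixes a :: "nat \<Rightarrow> 's \<Rightarrow> 'c"
  assumes bound: "\<And>i s. s \<in> S \<Longrightarrow> dist (a i s) 0 \<le> M i" and M: "M \<longlonglongrightarrow> 0"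
  shows "uniform_limit S (\<lambda>n s. \<Sum>i<n. a i s) (\<lambda>s. \<Sum>i. a i s) sequentially"
proof -
  have "uniformly_Cauchy_on S (\<lambda>n s. \<Sum>i<n. a i s)"
  proof (rule uniformly_Cauchy_onI')
    fix e :: real assume e: "e > 0"
    then obtain N where N: "M i < e" if "i \<ge> N" for i
      using order_tendstoD(2)[OF M] by (auto simp: eventually_sequentially)
    have "dist (\<Sum>i<m. a i s) (\<Sum>i<n. a i s) < e" if "s \<in> S" "m \<ge> N" "n > m" for s m n
    proof -
      have "dist (\<Sum>i<m. a i s) (\<Sum>i<n. a i s) = dist (\<Sum>i\<in>{m..<n}. a i s) 0"
        using that sum_diff_nat_ivl[of 0 m n "\<lambda>i. a i s"]
        by (subst dist_commute, subst dist_conv_abs) (simp add: atLeast0LessThan)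
      also have "\<dots> < e"
      proof (rule abs_sum_less[OF e])
        show "dist (a i s) 0 < e" if "i \<in> {m..<n}" for i
          using that bound[OF \<open>s \<in> S\<close>, of i] N[of i] \<open>m \<ge> N\<close> by simp
      qed
      finally show ?thesis .
    qed
    then show "\<exists>N. \<forall>s\<in>S. \<forall>m\<ge>N. \<forall>n>m. dist (\<Sum>i<m. a i s) (\<Sum>i<n. a i s) < e"
      by blast
  qed
  then obtain l where l: "uniform_limit S (\<lambda>n s. \<Sum>i<n. a i s) l sequentially"
    using Cauchy_uniformly_convergent by (auto simp: uniformly_convergent_on_def)
  have "l s = (\<Sum>i. a i s)" if "s \<in> S" for s
    using tendsto_uniform_limitI[OF l that] by (intro sums_unique) (simp add: sums_def)
  then show ?thesis
    using l by (subst uniform_limit_cong') auto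
qed

lemma uniform_limit_carlitz_series:
  assumes "w \<longlonglongrightarrow> 0"
  shows "uniform_limit int_ring (\<lambda>n s. \<Sum>i<n. emb (carlitz_f i s) * w i) (carlitz_series emb w)
    sequentially"
proof -
  have "(\<lambda>i. dist (w i) 0) \<longlonglongrightarrow> 0"
    using assms by (simp flip: tendsto_dist_iff)
  moreover have "dist (emb (carlitz_f i s) * w i) 0 \<le> dist (w i) 0" if "s \<in> int_ring" for i s
    using abs_emb_le_1[OF carlitz_f_int_ring[OF that]] by (simp add: abs_mult mult_left_le_one_le)
  ultimately show ?thesis
    unfolding carlitz_series_def by (rule ultrametric_M_test[rotated])
qed

lemmas carlitz_series_sums = tendsto_uniform_limitI[OF uniform_limit_carlitz_series]

lemma uniform_limit_carlitz_slope_series: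
  assumes "(\<lambda>i. real CARD('a) ^ i * dist (w i) 0) \<longlonglongrightarrow> 0"
  shows "uniform_limit int_ring (\<lambda>n s. \<Sum>i<n. emb (carlitz_slope i s) * w i)
    (carlitz_slope_series emb w) sequentially"
  unfolding carlitz_slope_series_def
  by (rule ultrametric_M_test[OF _ assms])
     (simp add: abs_mult abs_emb_carlitz_slope_le mult_right_mono)

lemmas carlitz_slope_series_sums = tendsto_uniform_limitI[OF uniform_limit_carlitz_slope_series]

lemma continuous_on_carlitz_slope_series:
  assumes "(\<lambda>i. real CARD('a) ^ i * dist (w i) 0) \<longlonglongrightarrow> 0"
  shows "continuous_on int_ring (carlitz_slope_series emb w)"
  by (rule uniform_limit_theorem[OF _ uniform_limit_carlitz_slope_series[OF assms]])
     (auto intro!: continuous_intros' continuous_on_emb_carlitz_slope always_eventually)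

lemma weights_tendsto_0:
  assumes "(\<lambda>i. real CARD('a) ^ i * dist (w i) 0) \<longlonglongrightarrow> 0"
  shows "w \<longlonglongrightarrow> (0 :: 'c)"
proof -
  have "1 * dist (w i) 0 \<le> real CARD('a) ^ i * dist (w i) 0" for i
    by (intro mult_right_mono) (simp_all add: Suc_le_eq)
  then show ?thesis
    using assms by (intro tendsto_dist_leI[of w]) auto
qed

lemma carlitz_series_eq_slope_series:
  assumes "(\<lambda>i. real CARD('a) ^ i * dist (w i) 0) \<longlonglongrightarrow> 0" "s \<in> int_ring"
  shows "carlitz_series emb w s = emb s * carlitz_slope_series emb w s"
proof (rule LIMSEQ_unique)
  show "(\<lambda>n. \<Sum>i<n. emb (carlitz_f i s) * w i) \<longlonglongrightarrow> carlitz_series emb w s"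
    using assms weights_tendsto_0 by (intro carlitz_series_sums)
  show "(\<lambda>n. \<Sum>i<n. emb (carlitz_f i s) * w i) \<longlonglongrightarrow> emb s * carlitz_slope_series emb w s"
    using tendsto_mult'[OF tendsto_const carlitz_slope_series_sums[OF assms], of "emb s"]
    by (simp add: carlitz_f_eq_slope emb_mult sum_distrib_left mult.assoc)
qed

text \<open>Linearity passes from the partial sums to the limit, continuity by uniform convergence;
  \<open>restrict\<close> matches the extensional functions in \<open>C0\<close>.\<close>

lemma carlitz_series_C0:
  assumes "w \<longlonglongrightarrow> 0"
  shows "restrict (carlitz_series emb w) int_ring \<in> C0 emb"
proof -
  have "continuous_on int_ring (carlitz_series emb w)"
    by (rule uniform_limit_theorem[OF _ uniform_limit_carlitz_series[OF assms]])
       (auto intro!: continuous_intros' continuous_on_emb_carlitz_f always_eventually)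
  moreover have "carlitz_series emb w (s + t) = carlitz_series emb w s + carlitz_series emb w t"
    if "s \<in> int_ring" "t \<in> int_ring" for s t
  proof (rule LIMSEQ_unique)
    show "(\<lambda>n. \<Sum>i<n. emb (carlitz_f i (s + t)) * w i) \<longlonglongrightarrow> carlitz_series emb w (s + t)"
      using assms that by (intro carlitz_series_sums) auto
    show "(\<lambda>n. \<Sum>i<n. emb (carlitz_f i (s + t)) * w i) \<longlonglongrightarrow>
        carlitz_series emb w s + carlitz_series emb w t"
      using tendsto_add'[OF carlitz_series_sums[OF assms that(1)] carlitz_series_sums[OF assms that(2)]]
      by (simp add: carlitz_f_add emb_add distrib_right sum.distrib)
  qed
  moreover have "carlitz_series emb w (fls_const c * t) = emb (fls_const c) * carlitz_series emb w t"
    if "t \<in> int_ring" for c t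
  proof (rule LIMSEQ_unique)
    show "(\<lambda>n. \<Sum>i<n. emb (carlitz_f i (fls_const c * t)) * w i) \<longlonglongrightarrow>
        carlitz_series emb w (fls_const c * t)"
      using assms that by (intro carlitz_series_sums) auto
    show "(\<lambda>n. \<Sum>i<n. emb (carlitz_f i (fls_const c * t)) * w i) \<longlonglongrightarrow>
        emb (fls_const c) * carlitz_series emb w t"
      using tendsto_mult'[OF tendsto_const carlitz_series_sums[OF assms that], of "emb (fls_const c)"]
      by (simp add: carlitz_f_const_mult emb_mult sum_distrib_left mult.assoc)
  qed
  ultimately show ?thesis
    by (auto simp: C0_def cong: continuous_on_cong)
qed

lemma carlitz_series_C01:
  assumes "(\<lambda>i. real CARD('a) ^ i * dist (w i) 0) \<longlonglongrightarrow> 0"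
  shows "restrict (carlitz_series emb w) int_ring \<in> C01 emb"
  unfolding C01_def
  using carlitz_series_C0[OF weights_tendsto_0[OF assms]] continuous_on_carlitz_slope_series[OF assms]
  by (auto intro!: exI[of _ "carlitz_slope_series emb w"] simp: carlitz_series_eq_slope_series[OF assms])

lemma carlitz_series_indefinite_sum:
  fixes w :: "nat \<Rightarrow> 'c"
  defines "w' \<equiv> case_nat 0 (\<lambda>i. w i ^ CARD('a))"
  assumes w: "w \<longlonglongrightarrow> 0" "w' \<longlonglongrightarrow> 0" and t: "t \<in> int_ring"
  shows "carlitz_series emb w' (fls_X * t) - emb fls_X * carlitz_series emb w' t =
    carlitz_series emb w t ^ CARD('a)"
proof (rule LIMSEQ_unique)
  \<comment> \<open>The term of index 0 vanishes because \<open>w' 0 = 0\<close>; the remaining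
    \<open>n\<close> terms correspond, through the shift identity, to those of the series for
    \<open>w\<close>.\<close>
  let ?p = "\<lambda>n s. \<Sum>i<Suc n. emb (carlitz_f i s) * w' i"
  have lim: "(\<lambda>n. ?p n s) \<longlonglongrightarrow> carlitz_series emb w' s" if "s \<in> int_ring" for s
    using carlitz_series_sums[OF w(2) that] by (rule LIMSEQ_Suc)
  show "(\<lambda>n. ?p n (fls_X * t) - emb fls_X * ?p n t) \<longlonglongrightarrow>
      carlitz_series emb w' (fls_X * t) - emb fls_X * carlitz_series emb w' t"
    using t by (intro tendsto_diff' tendsto_mult' tendsto_const lim) auto
  have "?p n (fls_X * t) - emb fls_X * ?p n t = (\<Sum>i<n. emb (carlitz_f i t) * w i) ^ CARD('a)" for n
  proof -
    have "?p n (fls_X * t) - emb fls_X * ?p n t =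
        (\<Sum>i<n. emb (carlitz_f (Suc i) (fls_X * t) - fls_X * carlitz_f (Suc i) t) * w i ^ CARD('a))"
      unfolding sum.lessThan_Suc_shift
      by (simp add: w'_def emb_diff emb_mult left_diff_distrib sum_subtractf sum_distrib_left mult.assoc)
    also have "\<dots> = (\<Sum>i<n. emb (carlitz_f i t) * w i) ^ CARD('a)"
      unfolding carlitz_f_Suc_X_mult sum_power_card
      by (simp add: emb_power power_mult_distrib)
    finally show ?thesis .
  qed
  then show "(\<lambda>n. ?p n (fls_X * t) - emb fls_X * ?p n t) \<longlonglongrightarrow>
      carlitz_series emb w t ^ CARD('a)"
    using tendsto_power'[OF carlitz_series_sums[OF w(1) t]] by simp
qed

section \<open>Uniqueness of the indefinite sum\<close>

lemma fls_abs_X_power_mult_le: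
  fixes t :: "'a fls"
  assumes "t \<in> int_ring"
  shows "fls_abs (fls_X ^ k * t) \<le> (1 / real CARD('a)) ^ k"
proof -
  have "fls_abs (fls_X ^ k :: 'a fls) = (1 / real CARD('a)) ^ k"
    by (simp add: fls_abs_def fls_subdegree_pow power_int_minus power_one_over field_simps)
  \<comment> \<open>Multiplicativity on \<open>K\<close> is inherited from \<open>abs_mult\<close>
    through \<open>emb\<close>.\<close>
  moreover have "fls_abs (fls_X ^ k * t) = fls_abs (fls_X ^ k :: 'a fls) * fls_abs t"
    by (simp only: abs_extends[symmetric] emb_mult abs_mult)
  ultimately show ?thesis
    using assms by (simp add: int_ring_def mult_left_le)
qed

lemma fls_X_power_mult_tendsto_0:
  assumes "\<And>k. s k \<in> int_ring"
  shows "(\<lambda>k. fls_X ^ k * s k) \<longlonglongrightarrow> (0 :: 'a fls)"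
proof (rule tendsto_flsI)
  have lim: "(\<lambda>k. (1 / real CARD('a)) ^ k) \<longlonglongrightarrow> 0"
    using card_field_gt_1[where 'a = 'a] by (intro LIMSEQ_power_zero) simp
  have "(\<lambda>k. fls_abs (fls_X ^ k * s k)) \<longlonglongrightarrow> 0"
  proof (rule tendsto_sandwich[OF _ _ tendsto_const lim])
    show "eventually (\<lambda>k. fls_abs (fls_X ^ k * s k) \<le> (1 / real CARD('a)) ^ k) sequentially"
      by (intro always_eventually allI fls_abs_X_power_mult_le assms)
  qed (simp add: fls_abs_def)
  then show "(\<lambda>k. fls_abs (fls_X ^ k * s k - 0)) \<longlonglongrightarrow> 0" by simp
qed

text \<open>
  If \<open>d\<close> vanishes at \<open>1\<close>, then it vanishes on constants, so that \<open>d (c + x s) = d (x s) = x d (s)\<close>.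
  Hence \<open>d t\<close> is a value of \<open>d\<close> on \<open>x\<^sup>k O\<close> for every \<open>k\<close>, and continuity at \<open>0\<close> applies.
\<close>

lemma shift_homogeneous_eq_0:
  assumes cont: "continuous_on int_ring d"
    and add: "\<And>s t. s \<in> int_ring \<Longrightarrow> t \<in> int_ring \<Longrightarrow> d (s + t) = d s + d t"
    and const: "\<And>c t. t \<in> int_ring \<Longrightarrow> d (fls_const c * t) = emb (fls_const c) * d t"
    and shift: "\<And>t. t \<in> int_ring \<Longrightarrow> d (fls_X * t) = emb fls_X * d t"
    and one: "d 1 = 0"
    and t: "t \<in> int_ring"
  shows "d t = 0"
proof -
  have "\<exists>s\<in>int_ring. d t = d (fls_X ^ k * s)" if "t \<in> int_ring" for k t
    using that
  proof (induction k arbitrary: t)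
    case (Suc k)
    obtain c s where s: "s \<in> int_ring" "t = fls_const c + fls_X * s"
      using int_ring_decompose[OF Suc.prems] .
    obtain r where r: "r \<in> int_ring" "d s = d (fls_X ^ k * r)"
      using Suc.IH[OF s(1)] by blast
    have "d t = d (fls_X * s)"
      using s const[of 1 c] one by (simp add: add int_ring_mult)
    also have "\<dots> = d (fls_X * (fls_X ^ k * r))"
      using s r by (simp add: shift int_ring_mult int_ring_power)
    finally show ?case
      using r(1) by (auto simp: mult.assoc)
  qed auto
  then obtain s where s: "\<And>k. s k \<in> int_ring" "\<And>k. d t = d (fls_X ^ k * s k)"
    using t by metis
  have "(\<lambda>k. d (fls_X ^ k * s k)) \<longlonglongrightarrow> d 0"
    by (intro continuous_on_tendsto_compose[OF cont] fls_X_power_mult_tendsto_0 s(1) int_ring_0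
        always_eventually allI int_ring_mult int_ring_power int_ring_fls_X)
  then have "(\<lambda>k. d t) \<longlonglongrightarrow> d 0"
    by (simp flip: s(2))
  then have "d t = d 0"
    by (rule LIMSEQ_unique[OF tendsto_const])
  moreover have "d 0 = d 0 + d 0"
    by (metis add add_0 int_ring_0)
  then have "d 0 = 0"
    by (rule add_cancel_right_right[THEN iffD1])
  ultimately show ?thesis by simp
qed

text \<open>The difference of two solutions satisfies the homogeneous equation and vanishes at 1,
  hence on \<open>O\<close>; extensionality then yields the equality of functions required by
  \<open>THE\<close>.\<close>

lemma indefinite_sum_eqI:
  assumes u: "u \<in> C0 emb" "\<And>t. t \<in> int_ring \<Longrightarrow> u (fls_X * t) - emb fls_X * u t = f t ^ CARD('a)"
    "u 1 = 0"
  shows "indefinite_sum emb f = u"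
  unfolding indefinite_sum_def
proof (rule the_equality)
  fix v
  assume v: "v \<in> C0 emb \<and> (\<forall>t\<in>int_ring. v (fls_X * t) - emb fls_X * v t = f t ^ CARD('a)) \<and> v 1 = 0"
  have "v t - u t = 0" if "t \<in> int_ring" for t
  proof (rule shift_homogeneous_eq_0[of "\<lambda>t. v t - u t"])
    show "continuous_on int_ring (\<lambda>t. v t - u t)"
      using u v by (intro continuous_on_diff') (simp_all add: C0_def)
    show "v (fls_X * s) - u (fls_X * s) = emb fls_X * (v s - u s)" if "s \<in> int_ring" for s
    proof -
      have "v (fls_X * s) - emb fls_X * v s = u (fls_X * s) - emb fls_X * u s"
        using u(2) v that by simp
      then show ?thesis by (simp add: algebra_simps)
    qed
  qed (use u v that in \<open>auto simp: C0_def algebra_simps\<close>)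
  then show "v = u"
    using u(1) v by (intro extensionalityI[of v int_ring u]) (auto simp: C0_def PiE_def)
qed (use u in auto)

section \<open>Evaluation of the integral\<close>

lemma volkenborn_integral_eqI:
  assumes "f \<in> C01 emb" "u \<in> C0 emb"
    and "\<And>t. t \<in> int_ring \<Longrightarrow> u (fls_X * t) - emb fls_X * u t = f t ^ CARD('a)" "u 1 = 0"
    and "(\<lambda>n. u (fls_X ^ n) / emb (fls_X ^ n)) \<longlonglongrightarrow> l"
  shows "volkenborn_integral emb f = l"
  using assms by (simp add: volkenborn_integral_def indefinite_sum_eqI[of u] limI)

lemma volkenborn_carlitz_series:
  fixes w :: "nat \<Rightarrow> 'c"
  assumes w: "(\<lambda>i. real CARD('a) ^ i * dist (w i) 0) \<longlonglongrightarrow> 0"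
  shows "(\<lambda>i. (- 1) ^ (i + 1) / emb (carlitz_L (i + 1)) * w i ^ CARD('a)) sums
    volkenborn_integral emb (restrict (carlitz_series emb w) int_ring)"
proof -
  let ?q = "CARD('a)"
  define w' where "w' = case_nat 0 (\<lambda>i. w i ^ ?q)"
  have w': "(\<lambda>i. real ?q ^ i * dist (w' i) 0) \<longlonglongrightarrow> 0"
  proof (rule LIMSEQ_imp_Suc)
    have "(\<lambda>i. real ?q * (real ?q ^ i * dist (w i) 0) ^ ?q) \<longlonglongrightarrow> real ?q * 0 ^ ?q"
      by (intro tendsto_intros w)
    then have lim: "(\<lambda>i. real ?q * (real ?q ^ i * dist (w i) 0) ^ ?q) \<longlonglongrightarrow> 0"
      by (simp add: power_0_left)
    \<comment> \<open>Raising to the power \<open>q\<close> only strengthens the weight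
      \<open>q^i\<close>; the extra factor \<open>q\<close> pays for the index shift in
      \<open>w'\<close>.\<close>
    have "real ?q ^ Suc i * dist (w' (Suc i)) 0 \<le> real ?q * (real ?q ^ i * dist (w i) 0) ^ ?q" for i
    proof -
      have "real ?q ^ i \<le> (real ?q ^ i) ^ ?q"
        by (rule self_le_power) (simp_all add: Suc_le_eq)
      then have "real ?q ^ i * dist (w i) 0 ^ ?q \<le> (real ?q ^ i) ^ ?q * dist (w i) 0 ^ ?q"
        by (rule mult_right_mono) simp
      then show ?thesis
        by (simp add: w'_def abs_power power_mult_distrib)
    qed
    then show "(\<lambda>i. real ?q ^ Suc i * dist (w' (Suc i)) 0) \<longlonglongrightarrow> 0"
      by (intro tendsto_sandwich[OF _ _ tendsto_const lim]) auto
  qed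
  \<comment> \<open>On \<open>x^n\<close> the quotient defining the integral is the slope series,
    whose continuity at 0 gives the limit.\<close>
  have "(\<lambda>n. carlitz_slope_series emb w' (fls_X ^ n)) \<longlonglongrightarrow> carlitz_slope_series emb w' 0"
    using fls_X_power_mult_tendsto_0[of "\<lambda>_. 1"]
    by (intro continuous_on_tendsto_compose[OF continuous_on_carlitz_slope_series[OF w']])
       (auto intro!: always_eventually)
  moreover have "carlitz_series emb w' (fls_X ^ n) / emb (fls_X ^ n) =
      carlitz_slope_series emb w' (fls_X ^ n)" for n
    by (simp add: carlitz_series_eq_slope_series[OF w'] int_ring_power)
  moreover have "carlitz_series emb w' 1 = 0"
  proof -
    have "emb (carlitz_f i 1) * w' i = 0" for i
      by (cases i) (simp_all add: w'_def carlitz_f_Suc_1)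
    then show ?thesis by (simp only: carlitz_series_def suminf_zero)
  qed
  ultimately have *: "volkenborn_integral emb (restrict (carlitz_series emb w) int_ring) =
      carlitz_slope_series emb w' 0"
    using carlitz_series_indefinite_sum[of w, folded w'_def] w w'
    by (intro volkenborn_integral_eqI[OF carlitz_series_C01[OF w]
          carlitz_series_C0[OF weights_tendsto_0[OF w']]])
       (auto simp: int_ring_mult int_ring_power weights_tendsto_0)
  \<comment> \<open>Summing to \<open>Suc n\<close> lets the zero term \<open>w' 0\<close> be split
    off, which produces the indices \<open>i + 1\<close> of the claim.\<close>
  have "(\<lambda>n. \<Sum>i<Suc n. emb (carlitz_slope i 0) * w' i) \<longlonglongrightarrow> carlitz_slope_series emb w' 0"
    using carlitz_slope_series_sums[OF w'] by (intro LIMSEQ_Suc) simp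
  then show ?thesis
    unfolding * sums_def sum.lessThan_Suc_shift
    by (simp add: w'_def carlitz_slope_0 emb_divide emb_power emb_minus emb_one emb_mult
        del: carlitz_slope.simps)
qed

lemma volkenborn_power:
  "volkenborn_integral emb (\<lambda>t\<in>int_ring. emb t ^ (CARD('a) ^ n)) =
    - 1 / emb (carlitz_bracket (n + 1))"
proof -
  let ?q = "CARD('a)" and ?b = "emb (carlitz_bracket (Suc n))"
  \<comment> \<open>The power term alone solves the difference equation; the homogeneous solution
    \<open>t\<close> is subtracted to obtain \<open>g 1 = 0\<close>, and it alone contributes to the
    derivative at 0.\<close>
  define g where "g = (\<lambda>t. (emb t ^ ?q ^ Suc n - emb t) / ?b)"
  have b: "?b \<noteq> 0"
    by (simp add: carlitz_bracket_nonzero)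
  have add: "(a + b) ^ ?q ^ k = a ^ ?q ^ k + b ^ ?q ^ k" for a b :: 'c and k
    by (induction k) (simp_all add: power_mult add_power_card mult.commute[of ?q])
  have const: "emb (fls_const c) ^ ?q ^ k = emb (fls_const c)" for c k
    by (induction k)
       (simp_all add: power_mult fls_const_power_card mult.commute[of ?q] flip: emb_power)
  have f: "(\<lambda>t\<in>int_ring. emb t ^ ?q ^ n) \<in> C01 emb"
  proof -
    have "(\<lambda>t\<in>int_ring. emb t ^ ?q ^ n) \<in> C0 emb"
      by (auto simp: C0_def emb_add emb_mult power_mult_distrib add const int_ring_add int_ring_mult
          intro!: continuous_intros' cong: continuous_on_cong)
    \<comment> \<open>The left side is the continuous extension to \<open>t = 0\<close>; for
      \<open>n = 0\<close> it is the constant 1.\<close>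
    moreover have "emb t ^ (?q ^ n - 1) = emb t ^ ?q ^ n / emb t" if "t \<noteq> 0" for t
      using that power_Suc[of "emb t" "?q ^ n - 1"] by (simp add: field_simps)
    ultimately show ?thesis
      unfolding C01_def
      by (intro CollectI conjI exI[of _ "\<lambda>t. emb t ^ (?q ^ n - 1)"] continuous_intros') auto
  qed
  have u: "restrict g int_ring \<in> C0 emb"
  proof -
    have "continuous_on int_ring g"
      unfolding g_def by (intro continuous_intros')
    moreover have "g (s + t) = g s + g t" for s t
      unfolding g_def emb_add add by (simp add: diff_divide_distrib add_divide_distrib)
    moreover have "g (fls_const c * t) = emb (fls_const c) * g t" for c t
      unfolding g_def emb_mult power_mult_distrib const by (simp add: right_diff_distrib)
    ultimately show ?thesis
      by (auto simp: C0_def int_ring_add int_ring_mult cong: continuous_on_cong)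
  qed
  have eq: "g (fls_X * t) - emb fls_X * g t = (emb t ^ ?q ^ n) ^ ?q" for t
  proof -
    have "g (fls_X * t) - emb fls_X * g t =
        (emb fls_X ^ ?q ^ Suc n - emb fls_X) * emb t ^ ?q ^ Suc n / ?b"
      by (simp add: g_def emb_mult power_mult_distrib diff_divide_distrib algebra_simps del: power_Suc)
    also have "emb fls_X ^ ?q ^ Suc n - emb fls_X = ?b"
      by (simp add: carlitz_bracket_def emb_diff emb_power del: power_Suc)
    finally show ?thesis
      using b by (simp add: mult.commute flip: power_mult)
  qed
  have "g (fls_X ^ k) / emb (fls_X ^ k) = (emb (fls_X ^ k) ^ (?q ^ Suc n - 1) - 1) / ?b" for k
  proof -
    have "emb (fls_X ^ k) ^ ?q ^ Suc n = emb (fls_X ^ k) * emb (fls_X ^ k) ^ (?q ^ Suc n - 1)"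
      using power_Suc[of "emb (fls_X ^ k)" "?q ^ Suc n - 1"] by simp
    then show ?thesis
      using b by (simp add: g_def field_simps del: power_Suc)
  qed
  moreover have "(\<lambda>k. (emb (fls_X ^ k) ^ (?q ^ Suc n - 1) - 1) / ?b) \<longlonglongrightarrow> - 1 / ?b"
  proof -
    have "?q ^ Suc n > 1"
      using card_field_gt_1[where 'a = 'a] by (intro one_less_power) auto
    moreover have "(\<lambda>k. (emb (fls_X ^ k) ^ (?q ^ Suc n - 1) - 1) / ?b) \<longlonglongrightarrow>
        (emb 0 ^ (?q ^ Suc n - 1) - 1) / ?b"
      using fls_X_power_mult_tendsto_0[of "\<lambda>_. 1"]
      by (intro continuous_on_tendsto_compose[of UNIV "\<lambda>t. (emb t ^ (?q ^ Suc n - 1) - 1) / ?b"]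
          continuous_intros') auto
    ultimately show ?thesis
      by (simp add: power_0_left)
  qed
  ultimately show ?thesis
    using eq by (intro volkenborn_integral_eqI[OF f u]) (auto simp: int_ring_mult int_ring_power g_def emb_one)
qed

lemma volkenborn_carlitz_f:
  "volkenborn_integral emb (\<lambda>t\<in>int_ring. emb (carlitz_f n t)) =
    (- 1) ^ (n + 1) / emb (carlitz_L (n + 1))"
proof -
  define w :: "nat \<Rightarrow> 'c" where "w i = (if i = n then 1 else 0)" for i
  have "eventually (\<lambda>i. real CARD('a) ^ i * dist (w i) 0 = 0) sequentially"
    using eventually_gt_at_top[of n] by eventually_elim (simp add: w_def)
  then have "(\<lambda>i. real CARD('a) ^ i * dist (w i) 0) \<longlonglongrightarrow> 0"
    by (rule tendsto_eventually)
  note integral = volkenborn_carlitz_series[OF this]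
  have series: "carlitz_series emb w = (\<lambda>s. emb (carlitz_f n s))"
  proof
    show "carlitz_series emb w s = emb (carlitz_f n s)" for s
      using sums_single[of n "\<lambda>i. emb (carlitz_f i s)"]
      by (simp add: carlitz_series_def w_def if_distrib[of "(*) _"] sums_iff cong: if_cong)
  qed
  have "(\<lambda>i. (- 1) ^ (i + 1) / emb (carlitz_L (i + 1)) * w i ^ CARD('a)) sums
      ((- 1) ^ (n + 1) / emb (carlitz_L (n + 1)))"
  proof -
    have "(- 1) ^ (i + 1) / emb (carlitz_L (i + 1)) * w i ^ CARD('a) =
        (if i = n then (- 1) ^ (i + 1) / emb (carlitz_L (i + 1)) else 0)" for i
      by (simp add: w_def power_0_left)
    then show ?thesis
      using sums_single[of n "\<lambda>i. (- 1) ^ (i + 1) / emb (carlitz_L (i + 1))"] by presburger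
  qed
  from sums_unique2[OF integral this] show ?thesis
    unfolding series .
qed

lemma volkenborn_carlitz_module:
  assumes "fls_abs z < 1"
  shows "volkenborn_integral emb (\<lambda>s\<in>int_ring. carlitz_module emb s z) = carlitz_log emb z - emb z"
proof -
  let ?q = "CARD('a)"
  define w where "w i = emb z ^ ?q ^ i" for i
  let ?I = "volkenborn_integral emb (restrict (carlitz_series emb w) int_ring)"
  have "fls_abs z \<ge> 0"
    by (simp add: fls_abs_def)
  \<comment> \<open>The required decay of \<open>q^i * |z|^(q^i)\<close> is that of the subsequence
    of \<open>n * |z|^n\<close> at \<open>n = q^i\<close>.\<close>
  then have "(\<lambda>n. real n * fls_abs z ^ n) \<longlonglongrightarrow> 0"
    using powser_times_n_limit_0[of "fls_abs z"] assms by simp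
  moreover have "filterlim (\<lambda>i. ?q ^ i) sequentially sequentially"
    using card_field_gt_1[where 'a = 'a]
    by (intro filterlim_subseq) (simp add: strict_mono_def power_strict_increasing)
  ultimately have "(\<lambda>i. real (?q ^ i) * fls_abs z ^ ?q ^ i) \<longlonglongrightarrow> 0"
    by (rule filterlim_compose)
  then have "(\<lambda>i. real ?q ^ i * dist (w i) 0) \<longlonglongrightarrow> 0"
    by (simp add: w_def abs_power abs_extends)
  then have I: "(\<lambda>i. (- 1) ^ (i + 1) / emb (carlitz_L (i + 1)) * w i ^ ?q) sums ?I"
    by (rule volkenborn_carlitz_series)
  \<comment> \<open>The integral is the logarithm series without its term of index 0, which is
    \<open>z\<close>.\<close>
  have "(\<lambda>n. \<Sum>i<Suc n. (- 1) ^ i * emb z ^ ?q ^ i / emb (carlitz_L i)) \<longlonglongrightarrow> emb z + ?I"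
    using tendsto_add'[OF tendsto_const I[unfolded sums_def], of "emb z"]
    unfolding sum.lessThan_Suc_shift
    by (simp add: w_def emb_one mult.commute[of ?q] flip: power_mult)
  then have "(\<lambda>i. (- 1) ^ i * emb z ^ ?q ^ i / emb (carlitz_L i)) sums (emb z + ?I)"
    unfolding sums_def by (rule LIMSEQ_imp_Suc)
  then have "carlitz_log emb z = emb z + ?I"
    by (simp add: carlitz_log_def sums_iff)
  moreover have "(\<lambda>s. carlitz_module emb s z) = carlitz_series emb w"
    by (simp add: fun_eq_iff carlitz_module_def carlitz_series_def w_def)
  ultimately show ?thesis by simp
qed

end

theorem theorem4:
  fixes emb :: "'a::{field,finite} fls \<Rightarrow> 'c::{field,complete_space}" and A :: "'c set"
  assumes "completed_algebraic_closure emb A"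
  shows "(\<forall>n. volkenborn_integral emb (\<lambda>t\<in>int_ring. emb t ^ (CARD('a) ^ n))
              = - 1 / emb (carlitz_bracket (n + 1)))
       \<and> (\<forall>n. volkenborn_integral emb (\<lambda>t\<in>int_ring. emb (carlitz_f n t))
              = (- 1) ^ (n + 1) / emb (carlitz_L (n + 1)))
       \<and> (\<forall>z. fls_abs z < 1 \<longrightarrow>
              volkenborn_integral emb (\<lambda>s\<in>int_ring. carlitz_module emb s z)
              = carlitz_log emb z - emb z)"
proof -
  interpret completed_algebraic_closure emb A by fact
  show ?thesis
    using volkenborn_power volkenborn_carlitz_f volkenborn_carlitz_module by blast
qed

end
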